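(* Let $v(x)={}^t\!xQx$ be a positive definite quadratic form on $\mathbb{R}^n$, let $M$ be a nonempty proper subset of $[n]$, $\ell\in M$, $L=\{\ell\}$, $K=M\setminus L$, and fix $\mu^{(K)}\in\mathbb{R}^K$. Let $\pi(x)=x_\ell$, let $h^{(K)}=\{x\in\mathbb{R}^n\mid x_j=\mu_j,\ j\in K\}$, and let $x_0=c^{(Q;M^c)}(\tau^{(L,K)}(r_0))\in\mathrm{Eff}_{\ell^{\varrho+}}^{(Q;M^c)}$. Then $r_0=\pi(x_0)$, and if $a_0=v(x_0)$, then $$\pi(x_0)=\max_{x\in h^{(K)},\ v(x)\le a_0}\pi(x)\quad\text{and}\quad v(x_0)=\min_{x\in h^{(K)},\ \pi(x)\ge r_0}v(x).$$
   Context: $[n]=\{1,\dots,n\}$; $Q$ is symmetric positive definite. For a proper subset $S\subsetneq[n]$ with complement $S^c$, $Q^{(S^c)}$ is the principal submatrix of $Q$ indexed by $S^c$ and $Q^{(S^c\times S)}$ the submatrix with rows in $S^c$, columns in $S$. For $\tau\in\mathbb{R}^S$, $c^{(Q;S^c)}(\tau)\in\mathbb{R}^n$ is the vector with $j$-th component $\tau_j$ for $j\in S$, whose components indexed by $S^c$ form the unique solution $y$ of $Q^{(S^c)}y=-Q^{(S^c\times S)}\tau$ (for $S=\emptyset$ it is the zero vector). For $r\in\mathbb{R}$, $\tau^{(L,K)}(r)\in\mathbb{R}^M$ is the vector with $\ell$-th component $r$ and $j$-th component $\mu_j$ for $j\in K$. $\varrho^{(K)}=c^{(Q;K^c)}(\mu^{(K)})\in\mathbb{R}^n$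 and $\varrho=\varrho^{(K)}_\ell$ is its $\ell$-th component. $\mathrm{Eff}_{\ell^{\varrho+}}^{(Q;M^c)}=\{c^{(Q;M^c)}(\tau^{(L,K)}(r))\mid r\ge\varrho\}$ (a ray in $\mathbb{R}^n$). *)

theory Defs
  imports "HOL-Analysis.Analysis"
begin

text \<open>
  The index set \<open>[n]\<close> is the finite type \<open>'n\<close>, so \<open>\<real>\<^sup>n\<close> is \<open>real ^ 'n\<close>. For \<open>S :: 'n set\<close>, a vector
  of \<open>\<real>\<^sup>S\<close> is given by a function \<open>'n \<Rightarrow> real\<close> of which only the values on \<open>S\<close> are ever used.
\<close>

definition sym_pos_def :: "real ^ 'n ^ 'n \<Rightarrow> bool" where
  "sym_pos_def Q \<longleftrightarrow> transpose Q = Q \<and> (\<forall>x. x \<noteq> 0 \<longrightarrow> 0 < x \<bullet> (Q *v x))"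

definition quad_form :: "real ^ 'n ^ 'n \<Rightarrow> real ^ 'n \<Rightarrow> real" where
  "quad_form Q x = x \<bullet> (Q *v x)"

text \<open>
  \<open>eff_point Q T \<tau>\<close> is \<open>c\<^bsup>(Q;T)\<^esup>(\<tau>)\<close>, where \<open>T = S\<^sup>c\<close>. The second conjunct is
  the system \<open>Q\<^bsup>(T)\<^esup> y = - Q\<^bsup>(T \<times> S)\<^esup> \<tau>\<close> written row by row; lemma \<open>eff_point_ex1\<close> shows that the
  description is a proper one.
\<close>

definition eff_point :: "real ^ 'n ^ 'n \<Rightarrow> 'n set \<Rightarrow> ('n \<Rightarrow> real) \<Rightarrow> real ^ 'n" where
  "eff_point Q T \<tau> = (THE x. (\<forall>j\<in>-T. x $ j = \<tau> j) \<and>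
     (\<forall>i\<in>T. (\<Sum>k\<in>T. Q $ i $ k * x $ k) = - (\<Sum>k\<in>-T. Q $ i $ k * \<tau> k)))"

lemma eff_point_ex1:
  fixes Q :: "real ^ 'n ^ 'n"
  assumes "sym_pos_def Q"
  shows "\<exists>!x. (\<forall>j\<in>-T. x $ j = \<tau> j) \<and>
     (\<forall>i\<in>T. (\<Sum>k\<in>T. Q $ i $ k * x $ k) = - (\<Sum>k\<in>-T. Q $ i $ k * \<tau> k))"
    (is "\<exists>!x. ?P x")
proof -
  define f :: "real ^ 'n \<Rightarrow> real ^ 'n" where
    "f x = (\<chi> i. if i \<in> T then (Q *v x) $ i else x $ i)" for x
  have lin: "linear f"
    by (rule linearI)
       (auto simp: f_def vec_eq_iff matrix_vector_right_distrib matrix_vector_mult_scaleR)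
  have "x = 0" if "f x = 0" for x
  proof (rule ccontr)
    assume "x \<noteq> 0"
    then have "0 < x \<bullet> (Q *v x)"
      using assms by (simp add: sym_pos_def_def)
    moreover have "x $ i * (Q *v x) $ i = 0" for i
      using that by (cases "i \<in> T") (auto simp: f_def vec_eq_iff split: if_splits)
    ultimately show False
      by (simp add: inner_vec_def)
  qed
  then have inj: "inj f"
    using lin by (simp add: linear_injective_0)
  then have "bij f"
    using lin linear_injective_imp_surjective by (auto simp: bij_def)
  then have ex1: "\<exists>!x. f x = (\<chi> i. if i \<in> T then 0 else \<tau> i)"
    unfolding bij_iff by blast
  have "?P x \<longleftrightarrow> f x = (\<chi> i. if i \<in> T then 0 else \<tau> i)" for x
  proof -
    have split: "(Q *v x) $ i = (\<Sum>k\<in>T. Q $ i $ k * x $ k) + (\<Sum>k\<in>-T. Q $ i $ k * x $ k)" for i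
      unfolding matrix_vector_mult_def
      using sum.union_disjoint[of T "-T" "\<lambda>k. Q $ i $ k * x $ k"] by (simp add: Un_commute)
    have "f x = (\<chi> i. if i \<in> T then 0 else \<tau> i) \<longleftrightarrow>
        (\<forall>j\<in>-T. x $ j = \<tau> j) \<and> (\<forall>i\<in>T. (Q *v x) $ i = 0)"
      by (auto simp: f_def vec_eq_iff)
    also have "\<dots> \<longleftrightarrow> ?P x"
    proof (rule conj_cong[OF refl])
      assume "\<forall>j\<in>-T. x $ j = \<tau> j"
      then have "(\<Sum>k\<in>-T. Q $ i $ k * x $ k) = (\<Sum>k\<in>-T. Q $ i $ k * \<tau> k)" for i
        by (intro sum.cong) auto
      then show "(\<forall>i\<in>T. (Q *v x) $ i = 0) \<longleftrightarrow>
          (\<forall>i\<in>T. (\<Sum>k\<in>T. Q $ i $ k * x $ k) = - (\<Sum>k\<in>-T. Q $ i $ k * \<tau> k))"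
        by (simp add: split eq_neg_iff_add_eq_0)
    qed
    finally show ?thesis by simp
  qed
  with ex1 show ?thesis by simp
qed

text \<open>
  For \<open>L = {l}\<close>, the vector \<open>\<tau>\<^bsup>(L,K)\<^esup>(r)\<close> has value \<open>r\<close> at \<open>l\<close> and \<open>\<mu> j\<close> at \<open>j \<in> K\<close>; its values
  outside \<open>M = L \<union> K\<close> play no role.
\<close>

definition tau_LK :: "'n \<Rightarrow> ('n \<Rightarrow> real) \<Rightarrow> real \<Rightarrow> 'n \<Rightarrow> real" where
  "tau_LK l \<mu> r = \<mu>(l := r)"

definition rho :: "real ^ 'n ^ 'n \<Rightarrow> 'n set \<Rightarrow> ('n \<Rightarrow> real) \<Rightarrow> 'n \<Rightarrow> real" where
  "rho Q K \<mu> l = eff_point Q (-K) \<mu> $ l"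

definition eff_ray :: "real ^ 'n ^ 'n \<Rightarrow> 'n set \<Rightarrow> ('n \<Rightarrow> real) \<Rightarrow> 'n \<Rightarrow> (real ^ 'n) set" where
  "eff_ray Q M \<mu> l = {eff_point Q (-M) (tau_LK l \<mu> r) | r. rho Q (M - {l}) \<mu> l \<le> r}"

definition slice :: "'n set \<Rightarrow> ('n \<Rightarrow> real) \<Rightarrow> (real ^ 'n) set" where
  "slice K \<mu> = {x. \<forall>j\<in>K. x $ j = \<mu> j}"

text \<open>
  \<open>m\<close> is the attained maximum (minimum) of a possibly infinite set; the library's \<open>Max\<close> and \<open>Min\<close>
  are meant for finite sets only.
\<close>

definition is_maximum :: "real set \<Rightarrow> real \<Rightarrow> bool" where
  "is_maximum A m \<longleftrightarrow> m \<in> A \<and> (\<forall>a\<in>A. a \<le> m)"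

definition is_minimum :: "real set \<Rightarrow> real \<Rightarrow> bool" where
  "is_minimum A m \<longleftrightarrow> m \<in> A \<and> (\<forall>a\<in>A. m \<le> a)"

end

theory Submission
  imports Defs
begin

text \<open>
  The gradient \<open>Q x0\<close> vanishes off \<open>M\<close>, so for \<open>x\<close> in the slice only its \<open>l\<close>-th component \<open>g\<close>
  contributes to the expansion \<open>v(x) = v(x0) + 2 (x\<^sub>l - r0) g + v(x - x0)\<close>. If \<open>p\<close> is the efficient
  point of the slice itself, then \<open>(r0 - \<rho>) g = v(x0 - p)\<close>, which forces \<open>g \<ge> 0\<close> when \<open>r0 \<ge> \<rho>\<close>
  (with \<open>x0 = p\<close> and \<open>g = 0\<close> when \<open>r0 = \<rho>\<close>). Both optimality claims follow from the expansion.
\<close>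

text \<open>Once the coordinates outside \<open>T\<close> agree with \<open>\<tau>\<close>, row i of
  the defining system is row i of \<open>Q *v x\<close> set to zero. So the point is stationary for
  the quadratic form in every direction supported on \<open>T\<close>.\<close>

lemma eff_point_fixed_and_gradient:
  assumes "sym_pos_def Q"
  shows eff_point_fixed: "j \<notin> T \<Longrightarrow> eff_point Q T \<tau> $ j = \<tau> j"
    and eff_point_gradient: "i \<in> T \<Longrightarrow> (Q *v eff_point Q T \<tau>) $ i = 0"
proof -
  let ?x = "eff_point Q T \<tau>"
  have sys: "(\<forall>j\<in>-T. ?x $ j = \<tau> j) \<and>
     (\<forall>i\<in>T. (\<Sum>k\<in>T. Q $ i $ k * ?x $ k) = - (\<Sum>k\<in>-T. Q $ i $ k * \<tau> k))"
    unfolding eff_point_def by (rule theI'[OF eff_point_ex1[OF assms]])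
  then show fixed: "?x $ j = \<tau> j" if "j \<notin> T" for j
    using that by auto
  show "(Q *v ?x) $ i = 0" if "i \<in> T"
  proof -
    have "(Q *v ?x) $ i = (\<Sum>k\<in>T. Q $ i $ k * ?x $ k) + (\<Sum>k\<in>-T. Q $ i $ k * ?x $ k)"
      unfolding matrix_vector_mult_def
      using sum.union_disjoint[of T "-T" "\<lambda>k. Q $ i $ k * ?x $ k"] by (simp add: Un_commute)
    also have "(\<Sum>k\<in>-T. Q $ i $ k * ?x $ k) = (\<Sum>k\<in>-T. Q $ i $ k * \<tau> k)"
      using fixed by (intro sum.cong) auto
    finally show ?thesis
      using sys that by simp
  qed
qed

lemma quad_form_expand:
  assumes "sym_pos_def Q"
  shows "quad_form Q x = quad_form Q y + 2 * ((x - y) \<bullet> (Q *v y)) + quad_form Q (x - y)"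
proof -
  \<comment> \<open>Symmetry of \<open>Q\<close> merges the two cross terms.\<close>
  have "x \<bullet> (Q *v y) = y \<bullet> (Q *v x)"
    using assms dot_lmul_matrix[of x Q y] transpose_matrix_vector[of Q x]
    by (simp add: sym_pos_def_def inner_commute)
  then show ?thesis
    by (simp add: quad_form_def matrix_vector_mult_diff_distrib inner_diff_left inner_diff_right)
qed

lemma quad_form_pos: "sym_pos_def Q \<Longrightarrow> x \<noteq> 0 \<Longrightarrow> 0 < quad_form Q x"
  by (simp add: sym_pos_def_def quad_form_def)

lemma quad_form_nonneg: "sym_pos_def Q \<Longrightarrow> 0 \<le> quad_form Q x"
  by (cases "x = 0") (auto simp: quad_form_def dest: quad_form_pos[of Q x])

text \<open>Meant for a displacement that vanishes on \<open>M - {l}\<close> paired with a gradient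
  that vanishes off \<open>M\<close>: the supports meet at most in \<open>l\<close>.\<close>

lemma inner_eq_component:
  fixes x y :: "real ^ 'n"
  assumes "\<And>i. i \<noteq> l \<Longrightarrow> x $ i = 0 \<or> y $ i = 0"
  shows "x \<bullet> y = x $ l * y $ l"
proof -
  have "(\<Sum>i\<in>UNIV. x $ i * y $ i) = (\<Sum>i\<in>{l}. x $ i * y $ i)"
    using assms by (intro sum.mono_neutral_right) auto
  then show ?thesis
    by (simp add: inner_vec_def)
qed

lemma eff_point_gradient_nonneg:
  fixes Q :: "real ^ 'n ^ 'n"
  assumes Q: "sym_pos_def Q" and l: "l \<in> M"
    and r: "rho Q (M - {l}) \<mu> l \<le> r"
  shows "0 \<le> (Q *v eff_point Q (-M) (tau_LK l \<mu> r)) $ l"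
proof -
  define x where "x = eff_point Q (-M) (tau_LK l \<mu> r)"
  define p where "p = eff_point Q (-(M - {l})) \<mu>"
  have xl: "x $ l = r"
    using eff_point_fixed[OF Q, of l "-M"] l by (simp add: x_def tau_LK_def)
  have pl: "p $ l \<le> r"
    using r by (simp add: p_def rho_def)
  have on_K: "(x - p) $ i = 0" if "i \<in> M - {l}" for i
    using that eff_point_fixed[OF Q, of i "-M"] eff_point_fixed[OF Q, of i "-(M - {l})"]
    by (simp add: x_def p_def tau_LK_def)
  have grad_x: "(Q *v x) $ i = 0" if "i \<notin> M" for i
    using that eff_point_gradient[OF Q, of i "-M"] by (simp add: x_def)
  \<comment> \<open>The point \<open>p\<close> is stationary off \<open>M - {l}\<close>, hence at
    \<open>l\<close> as well; this makes \<open>Q *v p\<close> orthogonal to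
    \<open>x - p\<close>.\<close>
  have grad_p: "(Q *v p) $ i = 0" if "i \<notin> M - {l}" for i
    unfolding p_def using that by (intro eff_point_gradient[OF Q]) auto
  have "(x - p) \<bullet> (Q *v x) = (r - p $ l) * (Q *v x) $ l"
    using on_K grad_x inner_eq_component[of l "x - p" "Q *v x"] xl by fastforce
  moreover have "(x - p) \<bullet> (Q *v p) = 0"
    using on_K grad_p inner_eq_component[of l "x - p" "Q *v p"] by fastforce
  ultimately have v: "quad_form Q (x - p) = (r - p $ l) * (Q *v x) $ l"
    by (simp add: quad_form_def matrix_vector_mult_diff_distrib inner_diff_right)
  have "0 \<le> (Q *v x) $ l"
  \<comment> \<open>For \<open>x = p\<close> the identity \<open>v\<close> reads 0 = 0 and carries
    no sign, so \<open>grad_p\<close> at \<open>l\<close> is used instead. Otherwise the product is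
    positive and its first factor nonnegative, so the second is positive.\<close>
  proof (cases "x = p")
    case True
    then show ?thesis using grad_p[of l] by simp
  next
    case False
    then have "0 < (r - p $ l) * (Q *v x) $ l"
      using quad_form_pos[OF Q, of "x - p"] v by simp
    then show ?thesis
      using pl by (simp add: zero_less_mult_iff)
  qed
  then show ?thesis
    by (simp add: x_def)
qed

theorem theorem4p1p2:
  fixes Q :: "real ^ 'n ^ 'n" and M K :: "'n set" and l :: 'n and \<mu> :: "'n \<Rightarrow> real"
    and x0 :: "real ^ 'n" and r0 a0 :: real
  assumes "sym_pos_def Q"
    and "M \<noteq> {}" and "M \<subset> UNIV" and "l \<in> M" and "K = M - {l}"
    and "x0 = eff_point Q (-M) (tau_LK l \<mu> r0)"
    and "x0 \<in> eff_ray Q M \<mu> l"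
    and "a0 = quad_form Q x0"
  shows "r0 = x0 $ l \<and>
    is_maximum {x $ l | x. x \<in> slice K \<mu> \<and> quad_form Q x \<le> a0} (x0 $ l) \<and>
    is_minimum {quad_form Q x | x. x \<in> slice K \<mu> \<and> x $ l \<ge> r0} (quad_form Q x0)"
proof -
  note Q = \<open>sym_pos_def Q\<close>
  have comp_l: "eff_point Q (-M) (tau_LK l \<mu> r) $ l = r" for r
    using eff_point_fixed[OF Q, of l "-M"] \<open>l \<in> M\<close> by (simp add: tau_LK_def)
  have x0l: "x0 $ l = r0"
    using comp_l assms(6) by simp
  have slice0: "x0 \<in> slice K \<mu>"
    using eff_point_fixed[OF Q, of _ "-M"] assms(5,6) by (auto simp: slice_def tau_LK_def)
  \<comment> \<open>Membership in the ray only yields some parameter above the threshold; comparing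
    components at \<open>l\<close> identifies it with \<open>r0\<close>.\<close>
  have "rho Q (M - {l}) \<mu> l \<le> r0"
    using assms(7) comp_l x0l by (auto simp: eff_ray_def)
  then have g: "0 \<le> (Q *v x0) $ l"
    using eff_point_gradient_nonneg[OF Q \<open>l \<in> M\<close>] assms(6) by simp
  have expand: "quad_form Q x = a0 + 2 * ((x $ l - r0) * (Q *v x0) $ l) + quad_form Q (x - x0)"
    if "x \<in> slice K \<mu>" for x
  proof -
    have "(x - x0) $ i = 0 \<or> (Q *v x0) $ i = 0" if "i \<noteq> l" for i
      using \<open>x \<in> slice K \<mu>\<close> slice0 that eff_point_gradient[OF Q, of i "-M"] assms(5,6)
      by (cases "i \<in> M") (auto simp: slice_def)
    then have "(x - x0) \<bullet> (Q *v x0) = (x $ l - r0) * (Q *v x0) $ l"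
      using inner_eq_component[of l "x - x0" "Q *v x0"] x0l by simp
    then show ?thesis
      using quad_form_expand[OF Q, of x x0] assms(8) by simp
  qed
  have "a0 \<le> quad_form Q x" if "x \<in> slice K \<mu>" "r0 \<le> x $ l" for x
    using expand[OF that(1)] that(2) g quad_form_nonneg[OF Q, of "x - x0"] by simp
  moreover have "x $ l \<le> r0" if "x \<in> slice K \<mu>" "quad_form Q x \<le> a0" for x
  proof (rule ccontr)
    assume "\<not> x $ l \<le> r0"
    \<comment> \<open>The gradient component may be 0, so the strict inequality has to come from the
      form at \<open>x - x0\<close>, which is nonzero because its component at \<open>l\<close>
      is.\<close>
    then have "0 \<le> (x $ l - r0) * (Q *v x0) $ l" and "x - x0 \<noteq> 0"
      using g x0l by auto
    then show False
      using expand[OF that(1)] that(2) quad_form_pos[OF Q, of "x - x0"] by linarith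
  qed
  ultimately show ?thesis
    using slice0 x0l assms(8) by (auto simp: is_maximum_def is_minimum_def)
qed

end
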